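(* Let $(X,d)$ be a metric space and let $\mu$ be a continuous measure on $X$ with nonempty support and such that every closed ball has finite $\mu$-measure. Suppose that $M^c_\mu f(x)=M_\mu f(x)$ for all $f\in L^1_{\mathrm{loc}}(\mu)$ and all $x\in\operatorname{supp}(\mu)$. Then there does not exist a sequence of points $\{x_n\}_{n\ge1}\subseteq\operatorname{supp}(\mu)$ such that each point of the sequence is the midpoint of two other different points of the sequence and $\{x_n\}_{n\ge 1}$ has a limit which also belongs to $\operatorname{supp}(\mu)$.
   Context: Measures are positive Borel measures on $X$. A measure $\mu$ is continuous if $\mu(\{x\})=0$ for every $x\in X$. $\operatorname{supp}(\mu)$ is the set of points all of whose open neighbourhoods have positive $\mu$-measure. A point $z$ is a midpoint of $x$ and $y$ if $d(x,z)=d(z,y)=\tfrac12 d(x,y)$; "two other different points" means two points of the sequence which are distinct from each other and from the given point. A ball means a closed ball $B(x,r)=\{y\in X: d(x,y)\le r\}$ with $r>0$. $L^1_{\mathrm{loc}}(\mu)$ denotes the locally $\mu$-integrable functions (integrable on every ball). For $f\in L^1_{\mathrm{loc}}(\mu)$ and $x\in\operatorname{supp}(\mu)$, define $$M^c_\mu f(x)=\sup_{r>0}\frac{1}{\mu(B(x,r))}\int_{B(x,r)} f\,d\mu,\qquad M_\mu f(x)=\sup_{B:\,B\ni x}\frac{1}{\mu(B)}\int_B f\,d\mu,$$ where the second supremum is over all balls $B$ containing $x$, and the average $\frac1{\mu(B)}\int_B f\,d\mu$ is taken to be $0$ if $\mu(B)=0$. *)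

theory Defs
  imports "HOL-Analysis.Analysis"
begin

definition borel_measure_on :: "'a::metric_space measure \<Rightarrow> bool" where
  "borel_measure_on \<mu> \<longleftrightarrow> sets \<mu> = sets borel"

definition continuous_measure :: "'a::metric_space measure \<Rightarrow> bool" where
  "continuous_measure \<mu> \<longleftrightarrow> (\<forall>x. emeasure \<mu> {x} = 0)"

definition msupp :: "'a::metric_space measure \<Rightarrow> 'a set" where
  "msupp \<mu> = {x. \<forall>U. open U \<longrightarrow> x \<in> U \<longrightarrow> emeasure \<mu> U > 0}"

definition finite_on_balls :: "'a::metric_space measure \<Rightarrow> bool" where
  "finite_on_balls \<mu> \<longleftrightarrow> (\<forall>x r. r > 0 \<longrightarrow> emeasure \<mu> (cball x r) < \<infinity>)"

text \<open>Measurability of \<open>f\<close> itself is implied, since the balls around a fixed point exhaust the space.\<close>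

definition L1_loc :: "'a::metric_space measure \<Rightarrow> ('a \<Rightarrow> real) set" where
  "L1_loc \<mu> = {f. \<forall>x r. r > 0 \<longrightarrow> set_integrable \<mu> (cball x r) f}"

text \<open>For a set of infinite measure \<^const>\<open>measure\<close> returns \<open>0\<close>; this average is therefore
  meaningful only on sets of finite measure, such as the balls of a measure satisfying
  \<open>finite_on_balls\<close>.\<close>

definition average :: "'a::metric_space measure \<Rightarrow> ('a \<Rightarrow> real) \<Rightarrow> 'a set \<Rightarrow> real" where
  "average \<mu> f B =
     (if emeasure \<mu> B = 0 then 0 else (1 / measure \<mu> B) * set_lebesgue_integral \<mu> B f)"

text \<open>No absolute value is placed on \<open>f\<close>; the suprema are taken in the extended reals because they
  may be infinite.\<close>

definition centred_maximal :: "'a::metric_space measure \<Rightarrow> ('a \<Rightarrow> real) \<Rightarrow> 'a \<Rightarrow> ereal" where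
  "centred_maximal \<mu> f x = (SUP r\<in>{0<..}. ereal (average \<mu> f (cball x r)))"

definition uncentred_maximal :: "'a::metric_space measure \<Rightarrow> ('a \<Rightarrow> real) \<Rightarrow> 'a \<Rightarrow> ereal" where
  "uncentred_maximal \<mu> f x =
     (SUP B\<in>{B. (\<exists>c r. r > 0 \<and> B = cball c r) \<and> x \<in> B}. ereal (average \<mu> f B))"

definition is_midpoint :: "'a::metric_space \<Rightarrow> 'a \<Rightarrow> 'a \<Rightarrow> bool" where
  "is_midpoint z x y \<longleftrightarrow> dist x z = dist x y / 2 \<and> dist z y = dist x y / 2"

text \<open>The three points are required to differ as points of the space, not merely as indices.\<close>

definition midpoint_sequence :: "(nat \<Rightarrow> 'a::metric_space) \<Rightarrow> bool" where
  "midpoint_sequence s \<longleftrightarrow>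
     (\<forall>n. \<exists>i j. s i \<noteq> s j \<and> s i \<noteq> s n \<and> s j \<noteq> s n \<and> is_midpoint (s n) (s i) (s j))"

end

(* The supremum defining the maximal functions carries no absolute value, so f may be chosen very
   negative outside a ball B containing x.  Equality of the two maximal functions then forces B to be
   comparable, up to null sets, with every ball centred at x.  If x were the midpoint of y and z
   in the support, at distance r from each, then the balls of radius 3r/2 around y and z would both
   contain x, and comparing them with the balls around x would make them comparable with each other.
   This is impossible, since neither contains the centre of the other.  Hence a single midpoint in
   the support already contradicts the hypothesis. *)
theory Submission
  imports Defs
begin

lemma borel_measure_on_sets:
  assumes "borel_measure_on \<mu>"
  shows "open U \<Longrightarrow> U \<in> sets \<mu>" "closed C \<Longrightarrow> C \<in> sets \<mu>"
  using assms by (auto simp: borel_measure_on_def)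

lemma fmeasurable_cball:
  assumes "borel_measure_on \<mu>" "finite_on_balls \<mu>" "r > 0"
  shows "cball c r \<in> fmeasurable \<mu>"
  using assms by (intro fmeasurableI) (auto simp: borel_measure_on_def finite_on_balls_def)

text \<open>Otherwise \<open>interior A - C\<close> would be an open neighbourhood of
  \<open>x\<close> inside the null set \<open>A - C\<close>, against \<open>x\<close> lying in the
  support.\<close>

lemma msupp_interior_mem:
  assumes "borel_measure_on \<mu>" "x \<in> msupp \<mu>" "A - C \<in> null_sets \<mu>" "x \<in> interior A" "closed C"
  shows "x \<in> C"
proof (rule ccontr)
  assume "x \<notin> C"
  then have "emeasure \<mu> (interior A - C) > 0"
    using assms open_Diff[OF open_interior assms(5), of A] by (auto simp: msupp_def)
  moreover have "emeasure \<mu> (interior A - C) \<le> emeasure \<mu> (A - C)"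
    using assms(3) interior_subset by (intro emeasure_mono) (auto dest: null_setsD2)
  ultimately show False
    using assms(3) by (simp add: null_sets_def)
qed

lemma null_sets_Diff_trans:
  assumes "A - B \<in> null_sets M" "B - C \<in> null_sets M" "A - C \<in> sets M"
  shows "A - C \<in> null_sets M"
  by (rule null_sets_subset[OF null_sets.Un[OF assms(1,2)] assms(3)]) auto

text \<open>\<open>D\<close> will be the complement of a ball, possibly of infinite measure; cutting
  with \<open>C\<close> leaves two indicators of sets of finite measure.\<close>

lemma
  assumes C: "C \<in> fmeasurable M" and A: "A \<in> sets M" and D: "D \<in> sets M"
  shows set_integrable_indicator_diff:
      "set_integrable M C (\<lambda>u. indicator A u - N * indicator D u :: real)"
    and set_integral_indicator_diff:
      "(LINT u:C|M. indicator A u - N * indicator D u) =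
        measure M (C \<inter> A) - N * measure M (C \<inter> D)"
proof -
  have f: "C \<inter> A \<in> fmeasurable M" "C \<inter> D \<in> fmeasurable M"
    using assms by (auto intro: fmeasurable_Int_fmeasurable)
  have i: "integrable M (indicator (C \<inter> A) :: _ \<Rightarrow> real)"
      "integrable M (indicator (C \<inter> D) :: _ \<Rightarrow> real)"
    using f by (auto simp: fmeasurable_def)
  have e: "indicator C u *\<^sub>R (indicator A u - N * indicator D u)
      = indicator (C \<inter> A) u - N * indicator (C \<inter> D) u" for u
    by (auto simp: indicator_def)
  show "set_integrable M C (\<lambda>u. indicator A u - N * indicator D u :: real)"
    unfolding set_integrable_def e using i by auto
  show "(LINT u:C|M. indicator A u - N * indicator D u) =
      measure M (C \<inter> A) - N * measure M (C \<inter> D)"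
    unfolding set_lebesgue_integral_def e using i f
    by (simp add: fmeasurableD sets.Int_space_eq2)
qed

text \<open>If both differences had positive measure, a function equal to 1 on \<open>B - V\<close>,
  0 on the rest of \<open>B\<close> and very negative off \<open>B\<close> would have a positive
  average over \<open>B\<close> but none over a ball centred at \<open>x\<close>: such a ball either
  misses \<open>B - V\<close> or swallows \<open>W - B\<close>. Two sets \<open>V\<close> and
  \<open>W\<close> are allowed so that an open ball can be paired with the closed ball of the same
  radius.\<close>

lemma centred_balls_comparable:
  fixes \<mu> :: "'a::metric_space measure"
  assumes bm: "borel_measure_on \<mu>" and fb: "finite_on_balls \<mu>"
    and eq: "\<And>f. f \<in> L1_loc \<mu> \<Longrightarrow> centred_maximal \<mu> f x = uncentred_maximal \<mu> f x"
    and B: "B = cball c s" "s > 0" "x \<in> B"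
    and V: "V \<in> sets \<mu>" and W: "W \<in> fmeasurable \<mu>"
    and VW: "\<And>t. t > 0 \<Longrightarrow> cball x t \<subseteq> V \<or> W \<subseteq> cball x t"
  shows "B - V \<in> null_sets \<mu> \<or> W - B \<in> null_sets \<mu>"
proof (rule ccontr)
  assume neg: "\<not> ?thesis"
  have Bf: "B \<in> fmeasurable \<mu>"
    using fmeasurable_cball[OF bm fb] B by auto
  then have Bm: "B \<in> sets \<mu>" by auto
  have BVf: "B - V \<in> fmeasurable \<mu>" and WBf: "W - B \<in> fmeasurable \<mu>"
    using Bf Bm V W by (auto intro: fmeasurable_Diff)
  have BVpos: "measure \<mu> (B - V) > 0" and WBpos: "measure \<mu> (W - B) > 0"
    using neg BVf WBf
    by (auto simp: null_sets_def zero_less_measure_iff emeasure_eq_measure2 fmeasurableD)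
  \<comment> \<open>With this weight the negative mass on \<open>W - B\<close> alone outweighs the
    positive mass, which is at most the measure of \<open>B\<close>.\<close>
  define N where "N = measure \<mu> B / measure \<mu> (W - B)"
  have N: "N \<ge> 0" "N * measure \<mu> (W - B) = measure \<mu> B"
    using WBpos by (auto simp: N_def)
  define f :: "'a \<Rightarrow> real" where "f = (\<lambda>u. indicator (B - V) u - N * indicator (- B) u)"
  have m: "B - V \<in> sets \<mu>" "- B \<in> sets \<mu>"
    using BVf Bm bm by (auto simp: borel_measure_on_def)
  have "f \<in> L1_loc \<mu>"
    unfolding L1_loc_def f_def
    using set_integrable_indicator_diff[OF fmeasurable_cball[OF bm fb] m] by auto
  have le0: "average \<mu> f (cball x t) \<le> 0" if t: "t > 0" for t
  proof -
    let ?C = "cball x t"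
    have C: "?C \<in> fmeasurable \<mu>" using fmeasurable_cball[OF bm fb t] .
    have "measure \<mu> (?C \<inter> (B - V)) \<le> N * measure \<mu> (?C \<inter> - B)"
      using VW[OF t]
    proof
      assume "?C \<subseteq> V"
      then have "?C \<inter> (B - V) = {}" by auto
      then show ?thesis using N by simp
    next
      assume WC: "W \<subseteq> ?C"
      have "measure \<mu> (?C \<inter> (B - V)) \<le> measure \<mu> B"
        using m C Bf by (intro measure_mono_fmeasurable) auto
      also have "\<dots> = N * measure \<mu> (W - B)" using N by simp
      also have "\<dots> \<le> N * measure \<mu> (?C \<inter> - B)"
        using WC WBf C m N(1)
        by (intro mult_left_mono measure_mono_fmeasurable) (auto intro: fmeasurable_Int_fmeasurable)
      finally show ?thesis .
    qed
    then show ?thesis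
      unfolding average_def f_def set_integral_indicator_diff[OF C m]
      by (auto intro: divide_nonpos_nonneg)
  qed
  have "centred_maximal \<mu> f x \<le> 0"
    unfolding centred_maximal_def using le0 by (intro SUP_least) auto
  moreover have "average \<mu> f B > 0"
  proof -
    have "measure \<mu> (B - V) \<le> measure \<mu> B"
      using m Bf by (intro measure_mono_fmeasurable) auto
    with BVpos have "measure \<mu> B > 0" by linarith
    moreover from this have "emeasure \<mu> B \<noteq> 0" by (auto simp: measure_def)
    moreover have "B \<inter> (B - V) = B - V" "B \<inter> - B = {}" by auto
    ultimately show ?thesis
      unfolding average_def f_def set_integral_indicator_diff[OF Bf m]
      using BVpos by simp
  qed
  moreover have "ereal (average \<mu> f B) \<le> uncentred_maximal \<mu> f x"
    unfolding uncentred_maximal_def using B by (intro SUP_upper) auto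
  ultimately show False
    using eq[OF \<open>f \<in> L1_loc \<mu>\<close>] by (metis ereal_less(2) leD order_trans)
qed

lemma no_midpoint_in_msupp:
  fixes \<mu> :: "'a::metric_space measure"
  assumes bm: "borel_measure_on \<mu>" and fb: "finite_on_balls \<mu>"
    and eq: "\<And>f. f \<in> L1_loc \<mu> \<Longrightarrow> centred_maximal \<mu> f x = uncentred_maximal \<mu> f x"
    and y: "y \<in> msupp \<mu>" and z: "z \<in> msupp \<mu>"
    and mid: "is_midpoint x y z" and ne: "y \<noteq> z"
  shows False
proof -
  define r where "r = dist x y"
  have d: "dist x y = r" "dist x z = r" "dist y x = r" "dist z x = r"
      "dist y z = 2 * r" "dist z y = 2 * r"
    using mid by (auto simp: is_midpoint_def r_def dist_commute)
  have r: "r > 0" using d(5) ne by (smt (verit) zero_less_dist_iff)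
  \<comment> \<open>A radius strictly between \<open>r\<close> and \<open>2 * r\<close> lets the
    ball contain \<open>x\<close> but miss the other endpoint, so each centre shows that its ball is
    not almost contained in the other one.\<close>
  define By where "By = cball y (3 / 2 * r)"
  define Bz where "Bz = cball z (3 / 2 * r)"
  note clo = borel_measure_on_sets[OF bm]
  have cl: "closed By" "closed Bz" and ms: "By \<in> sets \<mu>" "Bz \<in> sets \<mu>"
    using clo by (auto simp: By_def Bz_def)
  have yint: "y \<in> interior By" and zint: "z \<in> interior Bz"
    unfolding By_def Bz_def
    using r by (auto intro!: subsetD[OF interior_maximal[OF ball_subset_cball open_ball]])
  have out: "z \<notin> By" "y \<notin> Bz" and xin: "x \<in> By" "x \<in> Bz"
    using r d by (auto simp: By_def Bz_def)
  have no1: "By - Bz \<notin> null_sets \<mu>"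
    using msupp_interior_mem[OF bm y _ yint cl(2)] out by auto
  have no2: "Bz - By \<notin> null_sets \<mu>"
    using msupp_interior_mem[OF bm z _ zint cl(1)] out by auto
  have cmp: "Bz - cball x t \<in> null_sets \<mu> \<or> cball x t - Bz \<in> null_sets \<mu>" if "t > 0" for t
  proof (rule centred_balls_comparable[OF bm fb eq Bz_def _ xin(2)])
    show "cball x u \<subseteq> cball x t \<or> cball x t \<subseteq> cball x u" for u
      by (meson le_cases subset_cball)
  qed (use r that fmeasurable_cball[OF bm fb] in auto)
  \<comment> \<open>The critical radius is \<open>r\<close>, where both endpoints lie on the sphere
    around \<open>x\<close>. Since no closed ball around \<open>x\<close> falls strictly between
    \<open>ball x r\<close> and \<open>cball x r\<close>, the open ball can be used in one
    alternative and the closed ball in the other.\<close>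
  have "By - ball x r \<in> null_sets \<mu> \<or> cball x r - By \<in> null_sets \<mu>"
  proof (rule centred_balls_comparable[OF bm fb eq By_def _ xin(1)])
    show "cball x u \<subseteq> ball x r \<or> cball x r \<subseteq> cball x u" for u
      by (cases "u < r") auto
  qed (use r clo fmeasurable_cball[OF bm fb] in auto)
  then show False
  proof
    assume a: "By - ball x r \<in> null_sets \<mu>"
    \<comment> \<open>The other alternative of \<open>cmp\<close> would force \<open>z\<close> into
      \<open>cball x t\<close>, although its distance from \<open>x\<close> is
      \<open>r > t\<close>.\<close>
    have small: "cball x t - Bz \<in> null_sets \<mu>" if "0 < t" "t < r" for t
      using cmp[OF that(1)] msupp_interior_mem[OF bm z _ zint, of "cball x t"] d that by auto
    \<comment> \<open>The radii tend to \<open>r\<close> from below, exhausting the open ball;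
      \<open>n + 2\<close> keeps the radius positive at \<open>n = 0\<close>.\<close>
    have "(\<Union>n. cball x (r - r / real (n + 2)) - Bz) \<in> null_sets \<mu>"
      using r by (intro null_sets_UN small) (auto simp: field_simps intro: add_pos_nonneg)
    moreover have "ball x r - Bz \<subseteq> (\<Union>n. cball x (r - r / real (n + 2)) - Bz)"
    proof
      fix u assume u: "u \<in> ball x r - Bz"
      then obtain n where n: "inverse (real (Suc n)) < (r - dist x u) / r"
        using r reals_Archimedean[of "(r - dist x u) / r"] by auto
      have "r / real (n + 2) \<le> r * inverse (real (Suc n))"
        using r by (auto simp: field_simps)
      also have "\<dots> \<le> r - dist x u" using n r by (simp add: field_simps)
      finally have "u \<in> cball x (r - r / real (n + 2)) - Bz" using u by auto
      then show "u \<in> (\<Union>n. cball x (r - r / real (n + 2)) - Bz)" by blast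
    qed
    ultimately have "ball x r - Bz \<in> null_sets \<mu>"
      by (rule null_sets_subset[OF _ sets.Diff[OF clo(1)[OF open_ball] ms(2)]])
    \<comment> \<open>Up to null sets, \<open>By\<close> lies in \<open>ball x r\<close>, which lies
      in \<open>Bz\<close>.\<close>
    with a have "By - Bz \<in> null_sets \<mu>"
      by (rule null_sets_Diff_trans[OF _ _ sets.Diff[OF ms]])
    with no1 show False by simp
  next
    assume a: "cball x r - By \<in> null_sets \<mu>"
    \<comment> \<open>Beyond radius \<open>r\<close> the ball has \<open>y\<close> in its interior,
      and \<open>y\<close> is outside \<open>Bz\<close>; this excludes the other alternative of
      \<open>cmp\<close>.\<close>
    have large: "Bz - cball x t \<in> null_sets \<mu>" if "r < t" for t
    proof -
      have "y \<in> interior (cball x t)"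
        using d that by (auto intro!: interiorI[of "ball x t"])
      then have "cball x t - Bz \<notin> null_sets \<mu>"
        using msupp_interior_mem[OF bm y _ _ cl(2)] out by auto
      then show ?thesis using cmp[of t] r that by auto
    qed
    \<comment> \<open>Radii decreasing to \<open>r\<close> carry the almost inclusion of
      \<open>Bz\<close> over to the closed ball \<open>cball x r\<close>.\<close>
    have "(\<Union>n. Bz - cball x (r + 1 / real (n + 1))) \<in> null_sets \<mu>"
      by (intro null_sets_UN large) auto
    moreover have "Bz - cball x r \<subseteq> (\<Union>n. Bz - cball x (r + 1 / real (n + 1)))"
    proof
      fix u assume u: "u \<in> Bz - cball x r"
      then obtain n where "inverse (real (Suc n)) < dist x u - r"
        using reals_Archimedean[of "dist x u - r"] by auto
      then have "u \<in> Bz - cball x (r + 1 / real (n + 1))"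
        using u by (auto simp: inverse_eq_divide)
      then show "u \<in> (\<Union>n. Bz - cball x (r + 1 / real (n + 1)))" by blast
    qed
    ultimately have "Bz - cball x r \<in> null_sets \<mu>"
      by (rule null_sets_subset[OF _ sets.Diff[OF ms(2) clo(2)[OF closed_cball]]])
    with a have "Bz - By \<in> null_sets \<mu>"
      using null_sets_Diff_trans[OF _ _ sets.Diff[OF ms(2,1)]] by blast
    with no2 show False by simp
  qed
qed

theorem theorem1p3:
  fixes \<mu> :: "'a::metric_space measure"
  assumes "borel_measure_on \<mu>"
    and "continuous_measure \<mu>"
    and "msupp \<mu> \<noteq> {}"
    and "finite_on_balls \<mu>"
    and "\<And>f x. f \<in> L1_loc \<mu> \<Longrightarrow> x \<in> msupp \<mu> \<Longrightarrow> centred_maximal \<mu> f x = uncentred_maximal \<mu> f x"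
  shows "\<not> (\<exists>s :: nat \<Rightarrow> 'a. range s \<subseteq> msupp \<mu> \<and> midpoint_sequence s \<and>
                (\<exists>l \<in> msupp \<mu>. s \<longlonglongrightarrow> l))"
proof clarify
  fix s :: "nat \<Rightarrow> 'a"
  assume s: "range s \<subseteq> msupp \<mu>" and "midpoint_sequence s"
  then obtain i j where "s i \<noteq> s j" "is_midpoint (s 0) (s i) (s j)"
    unfolding midpoint_sequence_def by blast
  with s show False
    using no_midpoint_in_msupp[OF assms(1,4) assms(5), of "s 0" "s i" "s j"] by blast
qed

end
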